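(* Given any instance of sequential selection with expirations (SSE) with $n$ options and evaluation times bounded by $T$, the optimal value of the linear program $$\begin{aligned}\text{maximize}\quad & \sum_{t=1}^{nT}\sum_{j=1}^n v_j\, x_{j,t}\\ \text{s.t.}\quad & \sum_{t=1}^{nT}\frac{x_{j,t}}{p_j(t)}\le 1 && \forall j\in[n],\\ & \sum_{\tau\le t}\sum_{j=1}^n \overline F_{S_j}(t-\tau)\, x_{j,\tau}\le 1 && \forall t\in[nT],\\ & x_{j,t}\ge 0 && \forall j\in[n],\ t\in[nT]\end{aligned}$$ is an upper bound on the expected total value of the optimal online policy.
   Context: SSE problem. An instance consists of $n$ options. Option $j\in[n]=\{1,\dots,n\}$ has a deterministic value $v_j>0$, a random evaluation time $S_j$ and a random expiration time $E_j$, both taking positive integer values; all these $2n$ random variables are mutually independent, with known distributions and initially unknown realizations. Write $\overline F_{S_j}(t)=\Pr(S_j>t)$ and $p_j(t)=\Pr(E_j>t)$. Standing assumptions: there is $T\in\mathbb N$ with $\overline F_{S_j}(T)=0$ for all $j$, and $p_j(t)>0$ for all $t\ge 1$ and all $j$. Time is discrete, $t=1,2,\dots$. Option $j$ is unexpired at time $t$ iff $E_j>t$; all options are available at time $1$ (so $p_j(1)=1$). A decision-maker (DM) evaluates one option at a time. The DM is free at time 1. If the DM is free at time $t$, it selects one option $j$ that is unexpired at time $t$ and has not been selected before (if there is one); it is then busy for $S_j$ time units (free again at time $t+S_j$) and obtains value $v_j$. A selected option cannot be preempted and cannot expire. Meanwhile other options may expire. In particular, since evaluation times are at most $T$, all selections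 take place at times in $\{1,\dots,nT\}$. An online policy decides, when the DM is free, which available option to select, using only the information revealed so far (past decisions, realized evaluation times of completed options, which options have expired), and possibly internal randomness. Its value is the expected sum of the values of the selected options; the optimal online policy is one of maximum value. *)

theory Defs
  imports "HOL-Probability.Probability" "HOL-Probability.Product_PMF"
begin

definition tail :: "nat pmf \<Rightarrow> nat \<Rightarrow> real" where
  "tail D t = measure_pmf.prob D {x. x > t}"

locale sse_instance =
  fixes n T :: nat
    and v :: "nat \<Rightarrow> real"
    and S E :: "nat \<Rightarrow> nat pmf"
  assumes value_pos: "\<And>j. j \<in> {1..n} \<Longrightarrow> v j > 0"
    and eval_pos: "\<And>j s. j \<in> {1..n} \<Longrightarrow> s \<in> set_pmf (S j) \<Longrightarrow> s > 0"
    and expire_pos: "\<And>j e. j \<in> {1..n} \<Longrightarrow> e \<in> set_pmf (E j) \<Longrightarrow> e > 0"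
    and eval_bounded: "\<And>j. j \<in> {1..n} \<Longrightarrow> tail (S j) T = 0"
    and unexpired_pos: "\<And>j t. j \<in> {1..n} \<Longrightarrow> t \<ge> 1 \<Longrightarrow> tail (E j) t > 0"
    and available_start: "\<And>j. j \<in> {1..n} \<Longrightarrow> tail (E j) 1 = 1"

text \<open>Joint law of the realizations (s, e) of all evaluation and expiration times; the product
  makes the 2n variables mutually independent.\<close>

definition realizations ::
  "nat \<Rightarrow> (nat \<Rightarrow> nat pmf) \<Rightarrow> (nat \<Rightarrow> nat pmf) \<Rightarrow> ((nat \<Rightarrow> nat) \<times> (nat \<Rightarrow> nat)) pmf" where
  "realizations n S E = pair_pmf (Pi_pmf {1..n} 0 S) (Pi_pmf {1..n} 0 E)"

text \<open>The decisions made so far, in chronological order, as pairs (selected option, realized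
  evaluation time). The decision maker is free again only when the last evaluation is complete,
  so all these evaluation times are known whenever a decision is due.\<close>

type_synonym history = "(nat \<times> nat) list"

definition selected :: "history \<Rightarrow> nat set" where
  "selected h = fst ` set h"

text \<open>The time at which the decision maker is free after history h.\<close>

definition clock :: "history \<Rightarrow> nat" where
  "clock h = 1 + sum_list (map snd h)"

text \<open>The expirations observed up to the current time: Some of the expiration time for an option
  that has expired, None for one that has not. A selected option no longer expires, so its
  expiration time is never revealed.\<close>

type_synonym expirations = "nat \<Rightarrow> nat option"

definition observed :: "nat \<Rightarrow> (nat \<Rightarrow> nat) \<Rightarrow> history \<Rightarrow> expirations" where
  "observed n e h =
     (\<lambda>j. if j \<in> {1..n} \<and> j \<notin> selected h \<and> e j \<le> clock h then Some (e j) else None)"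

definition available :: "nat \<Rightarrow> history \<Rightarrow> expirations \<Rightarrow> nat set" where
  "available n h ob = {j \<in> {1..n}. j \<notin> selected h \<and> ob j = None}"

text \<open>A policy maps a random seed, drawn from a probability space R independently of the instance,
  and the information revealed so far to the option selected next. Whenever some option is
  available, one has to be selected.\<close>

type_synonym 'r policy = "'r \<Rightarrow> history \<Rightarrow> expirations \<Rightarrow> nat"

definition online_policies :: "nat \<Rightarrow> 'r measure \<Rightarrow> 'r policy set" where
  "online_policies n R =
     {\<pi>. (\<forall>h ob. (\<lambda>r. \<pi> r h ob) \<in> measurable R (count_space UNIV)) \<and>
         (\<forall>r \<in> space R. \<forall>h ob. available n h ob \<noteq> {} \<longrightarrow> \<pi> r h ob \<in> available n h ob)}"

text \<open>The history after k decisions. Once no option is available, none becomes available later, so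
  the history stays constant; in particular it is final after n decisions.\<close>

primrec run :: "nat \<Rightarrow> 'r policy \<Rightarrow> 'r \<Rightarrow> (nat \<Rightarrow> nat) \<Rightarrow> (nat \<Rightarrow> nat) \<Rightarrow> nat \<Rightarrow> history" where
  "run n \<pi> r s e 0 = []"
| "run n \<pi> r s e (Suc k) =
     (let h = run n \<pi> r s e k; ob = observed n e h; j = \<pi> r h ob in
      if available n h ob = {} then h else h @ [(j, s j)])"

definition total_value ::
  "nat \<Rightarrow> (nat \<Rightarrow> real) \<Rightarrow> 'r policy \<Rightarrow> 'r \<Rightarrow> (nat \<Rightarrow> nat) \<Rightarrow> (nat \<Rightarrow> nat) \<Rightarrow> real" where
  "total_value n v \<pi> r s e = (\<Sum>j \<in> selected (run n \<pi> r s e n). v j)"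

definition policy_value ::
  "nat \<Rightarrow> (nat \<Rightarrow> real) \<Rightarrow> (nat \<Rightarrow> nat pmf) \<Rightarrow> (nat \<Rightarrow> nat pmf) \<Rightarrow> 'r measure \<Rightarrow> 'r policy \<Rightarrow> real" where
  "policy_value n v S E R \<pi> =
     (\<integral>(r, s, e). total_value n v \<pi> r s e \<partial>(R \<Otimes>\<^sub>M measure_pmf (realizations n S E)))"

text \<open>Optimal values are suprema in the extended reals, where every set has one.\<close>

definition optimal_online_value ::
  "nat \<Rightarrow> (nat \<Rightarrow> real) \<Rightarrow> (nat \<Rightarrow> nat pmf) \<Rightarrow> (nat \<Rightarrow> nat pmf) \<Rightarrow> 'r measure \<Rightarrow> ereal" where
  "optimal_online_value n v S E R =
     (SUP \<pi> \<in> online_policies n R. ereal (policy_value n v S E R \<pi>))"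

definition lp_objective :: "nat \<Rightarrow> nat \<Rightarrow> (nat \<Rightarrow> real) \<Rightarrow> (nat \<Rightarrow> nat \<Rightarrow> real) \<Rightarrow> real" where
  "lp_objective n T v x = (\<Sum>t = 1..n * T. \<Sum>j = 1..n. v j * x j t)"

definition lp_feasible ::
  "nat \<Rightarrow> nat \<Rightarrow> (nat \<Rightarrow> nat pmf) \<Rightarrow> (nat \<Rightarrow> nat pmf) \<Rightarrow> (nat \<Rightarrow> nat \<Rightarrow> real) set" where
  "lp_feasible n T S E =
     {x. (\<forall>j \<in> {1..n}. (\<Sum>t = 1..n * T. x j t / tail (E j) t) \<le> 1) \<and>
         (\<forall>t \<in> {1..n * T}. (\<Sum>\<tau> = 1..t. \<Sum>j = 1..n. tail (S j) (t - \<tau>) * x j \<tau>) \<le> 1) \<and>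
         (\<forall>j \<in> {1..n}. \<forall>t \<in> {1..n * T}. x j t \<ge> 0)}"

definition lp_value ::
  "nat \<Rightarrow> nat \<Rightarrow> (nat \<Rightarrow> real) \<Rightarrow> (nat \<Rightarrow> nat pmf) \<Rightarrow> (nat \<Rightarrow> nat pmf) \<Rightarrow> ereal" where
  "lp_value n T v S E = (SUP x \<in> lp_feasible n T S E. ereal (lp_objective n T v x))"

end

theory Submission
  imports Defs
begin

text \<open>Fix the random seed and let \<open>x j t\<close> be the probability that the policy selects option \<open>j\<close> at
  time \<open>t\<close>. Whether this happens does not depend on the evaluation time of \<open>j\<close>, so
  \<open>tail (S j) (t - \<tau>) * x j \<tau>\<close> is the probability that \<open>j\<close> is selected at \<open>\<tau>\<close> and still busy at
  \<open>t\<close>; these events are disjoint for distinct \<open>(j, \<tau>)\<close>. It depends on the expiration time of \<open>j\<close>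
  only through \<open>E\<^sub>j > t\<close>, so \<open>x j t / tail (E j) t\<close> is the probability that \<open>j\<close> is selected at \<open>t\<close>
  in the modified instance where \<open>j\<close> never expires; these events are disjoint for distinct \<open>t\<close>.
  Hence \<open>x\<close> is feasible for every seed, and averaging over the seed preserves the bound.\<close>

section \<open>Independence of one coordinate in product laws\<close>

lemma nn_integral_Pi_pmf_coordinate:
  fixes F :: "('i \<Rightarrow> 'a) \<Rightarrow> ennreal"
  assumes I: "finite I" "j \<in> I"
    and F: "\<And>f y. F (f(j := y)) = F f"
  shows "(\<integral>\<^sup>+f. g (f j) * F f \<partial>Pi_pmf I d p) = (\<integral>\<^sup>+y. g y \<partial>p j) * (\<integral>\<^sup>+f. F f \<partial>Pi_pmf I d p)"
proof -
  let ?Q = "Pi_pmf (I - {j}) d p"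
  \<comment> \<open>Coordinate \<open>j\<close> is split off as an independent draw;
    \<open>F\<close> ignores it, so the iterated integral factors.\<close>
  have P: "Pi_pmf I d p = map_pmf (\<lambda>(y, f). f(j := y)) (pair_pmf (p j) ?Q)"
    using Pi_pmf_insert[of "I - {j}" j d p] I by (simp add: insert_absorb)
  show ?thesis
    unfolding P by (simp add: nn_integral_pair_pmf' case_prod_unfold F nn_integral_cmult nn_integral_multc)
qed

text \<open>For each fixed \<open>a\<close> the coordinate lemma splits the inner integral over
  \<open>f\<close>. This form serves expiration times; the mirrored one below serves evaluation
  times.\<close>

lemma prob_pair_Pi_pmf_snd_coordinate:
  assumes I: "finite I" "j \<in> I"
    and X: "\<And>a f y. X a (f(j := y)) = X a f"
  shows "measure_pmf.prob (pair_pmf M (Pi_pmf I d p)) {(a, f). f j \<in> A \<and> X a f} =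
    measure_pmf.prob (p j) A * measure_pmf.prob (pair_pmf M (Pi_pmf I d p)) {(a, f). X a f}"
proof -
  have *: "emeasure (pair_pmf M (Pi_pmf I d p)) {(a, f). Y a f} =
    (\<integral>\<^sup>+a. \<integral>\<^sup>+f. indicator {(a, f). Y a f} (a, f) \<partial>Pi_pmf I d p \<partial>M)" for Y
    by (subst nn_integral_pair_pmf'[symmetric]) simp
  have "emeasure (pair_pmf M (Pi_pmf I d p)) {(a, f). f j \<in> A \<and> X a f} =
    (\<integral>\<^sup>+a. \<integral>\<^sup>+f. indicator A (f j) * indicator {(a, f). X a f} (a, f) \<partial>Pi_pmf I d p \<partial>M)"
    unfolding * by (intro nn_integral_cong) (auto simp: indicator_def)
  also have "\<dots> = (\<integral>\<^sup>+a. emeasure (p j) A *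
      (\<integral>\<^sup>+f. indicator {(a, f). X a f} (a, f) \<partial>Pi_pmf I d p) \<partial>M)"
    by (subst nn_integral_Pi_pmf_coordinate[OF I]) (auto simp: indicator_def X)
  also have "\<dots> = emeasure (p j) A * emeasure (pair_pmf M (Pi_pmf I d p)) {(a, f). X a f}"
    unfolding * by (simp add: nn_integral_cmult)
  finally show ?thesis
    by (simp add: measure_def enn2real_mult)
qed

lemma prob_pair_Pi_pmf_fst_coordinate:
  assumes I: "finite I" "j \<in> I"
    and X: "\<And>f b y. X (f(j := y)) b = X f b"
  shows "measure_pmf.prob (pair_pmf (Pi_pmf I d p) M) {(f, b). f j \<in> A \<and> X f b} =
    measure_pmf.prob (p j) A * measure_pmf.prob (pair_pmf (Pi_pmf I d p) M) {(f, b). X f b}"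
proof -
  have "measure_pmf.prob (pair_pmf (Pi_pmf I d p) M) {(f, b). Y f b} =
    measure_pmf.prob (pair_pmf M (Pi_pmf I d p)) {(b, f). Y f b}" for Y
    by (subst pair_commute_pmf) (auto intro!: arg_cong2[where f = measure])
  then show ?thesis
    using prob_pair_Pi_pmf_snd_coordinate[OF I, of "\<lambda>b f. X f b" M d p A] X by simp
qed

text \<open>Both families of packing constraints of the linear program are reduced to this
  bound.\<close>

lemma sum_prob_disjoint_le_1:
  assumes "finite I"
    and "\<And>i i' x. i \<in> I \<Longrightarrow> i' \<in> I \<Longrightarrow> x \<in> A i \<Longrightarrow> x \<in> A i' \<Longrightarrow> i = i'"
  shows "(\<Sum>i\<in>I. measure_pmf.prob M (A i)) \<le> 1"
proof -
  have "disjoint_family_on A I"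
    using assms(2) by (fastforce simp: disjoint_family_on_def)
  then have "(\<Sum>i\<in>I. measure_pmf.prob M (A i)) = measure_pmf.prob M (\<Union>i\<in>I. A i)"
    using assms(1) by (intro measure_pmf.finite_measure_finite_Union[symmetric]) auto
  then show ?thesis by simp
qed

section \<open>Runs of a policy and their single decisions\<close>

lemma selected_append [simp]: "selected (h @ [(j, s)]) = insert j (selected h)"
  by (auto simp: selected_def)

lemma clock_append [simp]: "clock (h @ [(j, s)]) = clock h + s"
  by (simp add: clock_def)

text \<open>With both values beyond the clock, \<open>j\<close> is observed as \<open>None\<close>
  either way.\<close>

lemma observed_update:
  assumes "e j > clock h" "y > clock h"
  shows "observed n (e(j := y)) h = observed n e h"
  using assms by (auto simp: observed_def fun_eq_iff)

text \<open>Decisions \<open>k\<close> are counted from 0. Non-emptiness excludes the steps at which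
  \<open>run\<close> stays constant and the output of \<open>\<pi>\<close> has no effect.\<close>

definition selects ::
  "nat \<Rightarrow> 'r policy \<Rightarrow> 'r \<Rightarrow> (nat \<Rightarrow> nat) \<Rightarrow> (nat \<Rightarrow> nat) \<Rightarrow> nat \<Rightarrow> nat \<Rightarrow> nat \<Rightarrow> bool" where
  "selects n \<pi> r s e k j t \<longleftrightarrow>
     (let h = run n \<pi> r s e k; ob = observed n e h in
      available n h ob \<noteq> {} \<and> \<pi> r h ob = j \<and> clock h = t)"

lemma run_Suc_selects:
  "selects n \<pi> r s e k j t \<Longrightarrow> run n \<pi> r s e (Suc k) = run n \<pi> r s e k @ [(j, s j)]"
  by (auto simp: selects_def Let_def)

lemma run_Suc_cases:
  obtains "run n \<pi> r s e (Suc k) = run n \<pi> r s e k"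
  | j t where "selects n \<pi> r s e k j t"
proof (cases "available n (run n \<pi> r s e k) (observed n e (run n \<pi> r s e k)) = {}")
  case True
  then show ?thesis using that(1) by simp
next
  case False
  then show ?thesis using that(2) by (simp add: selects_def Let_def)
qed

lemma selected_run_mono: "k \<le> k' \<Longrightarrow> selected (run n \<pi> r s e k) \<subseteq> selected (run n \<pi> r s e k')"
  by (rule lift_Suc_mono_le) (auto simp: Let_def)

lemma clock_run_mono: "k \<le> k' \<Longrightarrow> clock (run n \<pi> r s e k) \<le> clock (run n \<pi> r s e k')"
  by (rule lift_Suc_mono_le) (auto simp: Let_def)

text \<open>The evaluation time of \<open>j\<close> enters the history only when \<open>j\<close> is
  appended.\<close>

lemma run_update_eval:
  assumes "j \<notin> selected (run n \<pi> r s e k)"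
  shows "run n \<pi> r (s(j := y)) e k = run n \<pi> r s e k"
  using assms by (induction k) (auto simp: Let_def split: if_splits)

lemma run_update_expire:
  assumes "e j > clock (run n \<pi> r s e k)" "y > clock (run n \<pi> r s e k)"
  shows "run n \<pi> r s (e(j := y)) k = run n \<pi> r s e k"
  using assms
proof (induction k)
  case (Suc k)
  \<comment> \<open>Earlier clocks are no larger, so the premises pass down to the induction
    hypothesis.\<close>
  have "clock (run n \<pi> r s e k) \<le> clock (run n \<pi> r s e (Suc k))"
    by (rule clock_run_mono) simp
  then have "e j > clock (run n \<pi> r s e k)" "y > clock (run n \<pi> r s e k)"
    using Suc.prems by linarith+
  with Suc.IH show ?case by (simp add: observed_update Let_def del: fun_upd_apply)
qed simp

lemma selected_run_selects:
  "j \<in> selected (run n \<pi> r s e m) \<Longrightarrow> \<exists>k<m. \<exists>t. selects n \<pi> r s e k j t"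
proof (induction m)
  case (Suc m)
  show ?case
  proof (cases rule: run_Suc_cases[of n \<pi> r s e m])
    case 1
    with Suc show ?thesis using less_SucI by metis
  next
    case (2 i t)
    with Suc show ?thesis
      by (metis insert_iff less_SucI lessI run_Suc_selects selected_append)
  qed
qed (simp add: selected_def)

lemma selects_time: "selects n \<pi> r s e k j t \<Longrightarrow> t = clock (run n \<pi> r s e k)"
  by (auto simp: selects_def Let_def)

section \<open>Pathwise properties of a valid policy at a fixed seed\<close>

context
  fixes n :: nat and \<pi> :: "'r policy" and r :: 'r
  assumes valid: "\<And>h ob. available n h ob \<noteq> {} \<Longrightarrow> \<pi> r h ob \<in> available n h ob"
begin

lemma selectsD:
  assumes "selects n \<pi> r s e k j t"
  shows "j \<in> {1..n}" "j \<notin> selected (run n \<pi> r s e k)" "e j > t"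
proof -
  let ?h = "run n \<pi> r s e k"
  have "j \<in> available n ?h (observed n e ?h)" "t = clock ?h"
    using assms valid[of ?h "observed n e ?h"] by (auto simp: selects_def Let_def)
  then show "j \<in> {1..n}" "j \<notin> selected ?h" "e j > t"
    by (auto simp: available_def observed_def split: if_splits)
qed

text \<open>When \<open>j\<close> is being selected it is not yet in the history, so its evaluation
  time has had no influence. The converse restores the old value \<open>s j\<close>.\<close>

lemma selects_update_eval_iff:
  "selects n \<pi> r (s(j := y)) e k j t \<longleftrightarrow> selects n \<pi> r s e k j t"
proof -
  have *: "selects n \<pi> r (s(j := y)) e k j t" if "selects n \<pi> r s e k j t" for s y
    using that run_update_eval[OF selectsD(2)[OF that]] by (simp add: selects_def)
  show ?thesis
    using *[of s y] *[of "s(j := y)" "s j"] by auto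
qed

lemma selects_update_expire:
  assumes "selects n \<pi> r s e k j t" "y > t"
  shows "selects n \<pi> r s (e(j := y)) k j t"
proof -
  have "e j > clock (run n \<pi> r s e k)" "y > clock (run n \<pi> r s e k)"
    using selectsD(3)[OF assms(1)] selects_time[OF assms(1)] assms(2) by auto
  then show ?thesis
    using assms(1) by (simp add: selects_def run_update_expire observed_update)
qed

text \<open>Up to time \<open>t\<close> all expiration times of \<open>j\<close> beyond
  \<open>t\<close> look alike. Overwriting \<open>e j\<close> by a fixed \<open>b\<close> leaves an
  event that ignores \<open>e j\<close>, as the independence lemma requires.\<close>

lemma selects_update_expire_iff:
  assumes "b > t"
  shows "selects n \<pi> r s e k j t \<longleftrightarrow> e j > t \<and> selects n \<pi> r s (e(j := b)) k j t"
  using selects_update_expire[of s e k j t b] selects_update_expire[of s "e(j := b)" k j t "e j"]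
    selectsD(3)[of s e k j t] assms by auto

text \<open>A selected option stays in the history and is never available again.\<close>

lemma selects_once:
  assumes "selects n \<pi> r s e k j t" "selects n \<pi> r s e k' j t'"
  shows "k = k'"
proof -
  have *: "\<not> k < k'" if "selects n \<pi> r s e k j t" "selects n \<pi> r s e k' j t'" for k k' t t'
  proof
    assume "k < k'"
    then have "selected (run n \<pi> r s e (Suc k)) \<subseteq> selected (run n \<pi> r s e k')"
      by (intro selected_run_mono) simp
    moreover have "j \<in> selected (run n \<pi> r s e (Suc k))"
      unfolding run_Suc_selects[OF that(1)] by simp
    ultimately show False
      using selectsD(2)[OF that(2)] by blast
  qed
  show ?thesis
    using *[OF assms] *[OF assms(2,1)] by simp
qed

text \<open>A later decision waits for the earlier evaluation to end, hence comes after
  \<open>t\<close>; so at most one decision keeps the DM busy at \<open>t\<close>.\<close>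

lemma selects_busy_unique:
  assumes "selects n \<pi> r s e k j \<tau>" "\<tau> \<le> t" "s j > t - \<tau>"
    and "selects n \<pi> r s e k' j' \<tau>'" "\<tau>' \<le> t" "s j' > t - \<tau>'"
  shows "k = k'"
proof -
  have *: "\<not> k < k'" if "selects n \<pi> r s e k j \<tau>" "s j > t - \<tau>"
      "selects n \<pi> r s e k' j' \<tau>'" "\<tau>' \<le> t" for k j \<tau> k' j' \<tau>'
  proof
    assume "k < k'"
    then have "clock (run n \<pi> r s e (Suc k)) \<le> clock (run n \<pi> r s e k')"
      by (intro clock_run_mono) simp
    then have "\<tau> + s j \<le> \<tau>'"
      unfolding run_Suc_selects[OF that(1)] selects_time[OF that(1)] selects_time[OF that(3)] by simp
    with that show False by linarith
  qed
  show ?thesis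
    using *[OF assms(1,3,4,5)] *[OF assms(4,6,1,2)] by simp
qed

lemma selected_run_subset: "selected (run n \<pi> r s e m) \<subseteq> {1..n}"
  using selected_run_selects[of _ n \<pi> r s e m] selectsD(1)[of s e] by blast

lemma clock_run_le:
  assumes "\<And>j. j \<in> {1..n} \<Longrightarrow> s j \<le> T"
  shows "clock (run n \<pi> r s e k) \<le> 1 + k * T"
proof (induction k)
  case (Suc k)
  show ?case
  proof (cases rule: run_Suc_cases[of n \<pi> r s e k])
    case 1
    then show ?thesis unfolding 1 using Suc.IH by simp
  next
    case (2 j t)
    have "s j \<le> T" using assms selectsD(1)[OF 2] by simp
    then show ?thesis unfolding run_Suc_selects[OF 2] using Suc.IH by simp
  qed
qed (simp add: clock_def)

section \<open>Selection probabilities as a solution of the linear program\<close>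

context
  fixes T :: nat and v :: "nat \<Rightarrow> real" and S E :: "nat \<Rightarrow> nat pmf"
  assumes inst: "sse_instance n T v S E"
begin

interpretation sse_instance n T v S E by (fact inst)

definition selection_prob :: "nat \<Rightarrow> nat \<Rightarrow> real" where
  "selection_prob j t =
     measure_pmf.prob (realizations n S E) {(s, e). \<exists>k. selects n \<pi> r s e k j t}"

lemma eval_le:
  assumes "(s, e) \<in> set_pmf (realizations n S E)" "j \<in> {1..n}"
  shows "s j \<in> {1..T}"
proof -
  have "s \<in> PiE_dflt {1..n} 0 (set_pmf \<circ> S)"
    using assms(1) by (simp add: realizations_def set_Pi_pmf)
  then have *: "s j \<in> set_pmf (S j)"
    using assms(2) by (auto simp: PiE_dflt_def)
  have "set_pmf (S j) \<inter> {x. x > T} = {}"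
    using eval_bounded[OF assms(2)] by (simp add: tail_def measure_pmf_zero_iff)
  with * show ?thesis
    using eval_pos[OF assms(2) *] by force
qed

lemma selects_time_bounds:
  assumes "(s, e) \<in> set_pmf (realizations n S E)" "selects n \<pi> r s e k j t" "k < n"
  shows "t \<in> {1..n * T}"
proof -
  \<comment> \<open>Some option is evaluated, so \<open>T\<close> is positive; this absorbs the
    initial 1 of the clock in \<open>1 + k * T\<close>.\<close>
  have "1 \<le> T"
    using eval_le[OF assms(1) selectsD(1)[OF assms(2)]] by simp
  have "t \<le> 1 + k * T"
    using clock_run_le[of s T e k] eval_le[OF assms(1)] selects_time[OF assms(2)] by simp
  also have "\<dots> \<le> Suc k * T"
    using \<open>1 \<le> T\<close> by simp
  also have "\<dots> \<le> n * T"
    using assms(3) by (intro mult_right_mono) auto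
  finally show ?thesis
    using selects_time[OF assms(2)] by (simp add: clock_def)
qed

lemma selection_prob_expire:
  assumes "j \<in> {1..n}" "t < b"
  shows "selection_prob j t = tail (E j) t *
    measure_pmf.prob (realizations n S E) {(s, e). \<exists>k. selects n \<pi> r s (e(j := b)) k j t}"
proof -
  have "selection_prob j t = measure_pmf.prob (realizations n S E)
      {(s, e). e j \<in> {x. x > t} \<and> (\<exists>k. selects n \<pi> r s (e(j := b)) k j t)}"
    unfolding selection_prob_def using selects_update_expire_iff[OF assms(2)]
    by (intro arg_cong2[where f = measure] refl) blast
  then show ?thesis
    unfolding realizations_def tail_def
    using prob_pair_Pi_pmf_snd_coordinate[of "{1..n}" j
        "\<lambda>s e. \<exists>k. selects n \<pi> r s (e(j := b)) k j t" "Pi_pmf {1..n} 0 S" 0 E "{x. x > t}"] assms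
    by simp
qed

lemma selection_prob_eval:
  assumes "j \<in> {1..n}"
  shows "tail (S j) m * selection_prob j t = measure_pmf.prob (realizations n S E)
    {(s, e). s j > m \<and> (\<exists>k. selects n \<pi> r s e k j t)}"
  unfolding selection_prob_def realizations_def tail_def
  using prob_pair_Pi_pmf_fst_coordinate[of "{1..n}" j
      "\<lambda>s e. \<exists>k. selects n \<pi> r s e k j t" 0 S "Pi_pmf {1..n} 0 E" "{x. x > m}"] assms
  by (simp add: selects_update_eval_iff)

lemma selection_prob_feasible: "selection_prob \<in> lp_feasible n T S E"
  unfolding lp_feasible_def
proof (intro CollectI conjI ballI)
  fix j assume j: "j \<in> {1..n}"
  \<comment> \<open>One expiration time beyond the whole horizon serves every \<open>t\<close>, so
    all events \<open>?A t\<close> concern the same modified realization and can be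
    compared.\<close>
  define b where "b = Suc (n * T)"
  let ?A = "\<lambda>t. {(s, e). \<exists>k. selects n \<pi> r s (e(j := b)) k j t}"
  have "selection_prob j t / tail (E j) t = measure_pmf.prob (realizations n S E) (?A t)"
    if "t \<in> {1..n * T}" for t
    using selection_prob_expire[OF j, of t b] unexpired_pos[OF j, of t] that by (simp add: b_def)
  then have "(\<Sum>t = 1..n * T. selection_prob j t / tail (E j) t) =
      (\<Sum>t = 1..n * T. measure_pmf.prob (realizations n S E) (?A t))"
    by (intro sum.cong refl)
  also have "\<dots> \<le> 1"
  proof (intro sum_prob_disjoint_le_1)
    fix t t' x assume "x \<in> ?A t" "x \<in> ?A t'"
    then obtain s e k k' where "selects n \<pi> r s e k j t" "selects n \<pi> r s e k' j t'"
      by auto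
    \<comment> \<open>In that realization \<open>j\<close> is selected by a single decision, whose
      index fixes the clock.\<close>
    then show "t = t'"
      using selects_once selects_time by metis
  qed simp
  finally show "(\<Sum>t = 1..n * T. selection_prob j t / tail (E j) t) \<le> 1" .
next
  fix t assume "t \<in> {1..n * T}"
  let ?A = "\<lambda>(\<tau>, j). {(s, e). s j > t - \<tau> \<and> (\<exists>k. selects n \<pi> r s e k j \<tau>)}"
  have "(\<Sum>\<tau> = 1..t. \<Sum>j = 1..n. tail (S j) (t - \<tau>) * selection_prob j \<tau>) =
      (\<Sum>(\<tau>, j) \<in> {1..t} \<times> {1..n}. measure_pmf.prob (realizations n S E) (?A (\<tau>, j)))"
    unfolding sum.cartesian_product
    by (intro sum.cong refl) (auto simp: selection_prob_eval)
  also have "\<dots> = (\<Sum>i \<in> {1..t} \<times> {1..n}. measure_pmf.prob (realizations n S E) (?A i))"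
    by (intro sum.cong) auto
  also have "\<dots> \<le> 1"
  proof (intro sum_prob_disjoint_le_1)
    fix i i' x
    assume "i \<in> {1..t} \<times> {1..n}" "i' \<in> {1..t} \<times> {1..n}" "x \<in> ?A i" "x \<in> ?A i'"
    then obtain \<tau> j \<tau>' j' s e k k' where x: "i = (\<tau>, j)" "i' = (\<tau>', j')"
      and sel: "selects n \<pi> r s e k j \<tau>" "\<tau> \<le> t" "s j > t - \<tau>"
        "selects n \<pi> r s e k' j' \<tau>'" "\<tau>' \<le> t" "s j' > t - \<tau>'"
      by (cases x) auto
    have "k = k'"
      by (rule selects_busy_unique[OF sel])
    \<comment> \<open>The index of a decision determines both its option and its time.\<close>
    with sel(1,4) show "i = i'"
      by (auto simp: x selects_def Let_def)
  qed simp
  finally show "(\<Sum>\<tau> = 1..t. \<Sum>j = 1..n. tail (S j) (t - \<tau>) * selection_prob j \<tau>) \<le> 1" .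
qed (simp add: selection_prob_def)

text \<open>On the support, each collected \<open>v j\<close> is matched by the indicator at its
  selection time, which lies within the horizon; the other terms are nonnegative. Taking
  expectations turns indicators into \<open>selection_prob\<close>.\<close>

lemma total_value_le_objective:
  "(\<integral>(s, e). total_value n v \<pi> r s e \<partial>realizations n S E) \<le> lp_objective n T v selection_prob"
proof -
  let ?M = "measure_pmf (realizations n S E)"
  let ?A = "\<lambda>j t. {(s, e). \<exists>k. selects n \<pi> r s e k j t}"
  let ?g = "\<lambda>x. \<Sum>t = 1..n * T. \<Sum>j = 1..n. v j * indicator (?A j t) x :: real"
  have integrable: "integrable ?M (\<lambda>x. v j * indicator (?A j t) x :: real)" for j t
    by (intro integrable_mult_right measure_pmf.integrable_const_bound[where B = 1]) auto
  \<comment> \<open>A uniform bound, which makes the total value integrable.\<close>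
  have bounded: "\<bar>total_value n v \<pi> r s e\<bar> \<le> (\<Sum>j = 1..n. \<bar>v j\<bar>)" for s e
    unfolding total_value_def
    by (rule order_trans[OF sum_abs], rule sum_mono2) (use selected_run_subset in auto)
  have le: "total_value n v \<pi> r s e \<le> ?g (s, e)" if se: "(s, e) \<in> set_pmf (realizations n S E)" for s e
  proof -
    have "v j \<le> (\<Sum>t = 1..n * T. v j * indicator (?A j t) (s, e))"
      if j: "j \<in> selected (run n \<pi> r s e n)" for j
    proof -
      obtain k t where k: "k < n" "selects n \<pi> r s e k j t"
        using selected_run_selects[OF j] by blast
      have "v j = v j * indicator (?A j t) (s, e)"
        using k(2) by (auto simp: indicator_def)
      also have "\<dots> \<le> (\<Sum>t = 1..n * T. v j * indicator (?A j t) (s, e))"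
        using selects_time_bounds[OF se k(2,1)] value_pos[OF selectsD(1)[OF k(2)]]
        by (intro member_le_sum) (auto simp: indicator_def)
      finally show ?thesis .
    qed
    then have "total_value n v \<pi> r s e \<le>
        (\<Sum>j \<in> selected (run n \<pi> r s e n). \<Sum>t = 1..n * T. v j * indicator (?A j t) (s, e))"
      unfolding total_value_def by (rule sum_mono)
    also have "\<dots> \<le> (\<Sum>j = 1..n. \<Sum>t = 1..n * T. v j * indicator (?A j t) (s, e))"
      using selected_run_subset value_pos
      by (intro sum_mono2 sum_nonneg mult_nonneg_nonneg) (auto intro: less_imp_le)
    finally show ?thesis
      by (subst sum.swap)
  qed
  have "(\<integral>(s, e). total_value n v \<pi> r s e \<partial>?M) \<le> (\<integral>x. ?g x \<partial>?M)"
  proof (rule integral_mono_AE)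
    show "integrable ?M (\<lambda>(s, e). total_value n v \<pi> r s e)"
      by (rule measure_pmf.integrable_const_bound[where B = "\<Sum>j = 1..n. \<bar>v j\<bar>"])
        (use bounded in auto)
    show "integrable ?M ?g"
      by (intro Bochner_Integration.integrable_sum integrable)
    show "AE x in ?M. (case x of (s, e) \<Rightarrow> total_value n v \<pi> r s e) \<le> ?g x"
      using le by (auto simp: AE_measure_pmf_iff)
  qed
  also have "\<dots> = lp_objective n T v selection_prob"
    unfolding lp_objective_def selection_prob_def
    by (subst Bochner_Integration.integral_sum,
        intro Bochner_Integration.integrable_sum integrable, intro sum.cong refl,
        subst Bochner_Integration.integral_sum, rule integrable, simp)
  finally show ?thesis .
qed

lemma total_value_le_lp:
  "ereal (\<integral>(s, e). total_value n v \<pi> r s e \<partial>realizations n S E) \<le> lp_value n T v S E"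
  unfolding lp_value_def
  by (rule SUP_upper2[OF selection_prob_feasible]) (simp add: total_value_le_objective)

end

end

section \<open>Averaging over the random seed\<close>

lemma zero_le_lp_value: "0 \<le> lp_value n T v S E"
proof -
  have "(\<lambda>_ _. 0) \<in> lp_feasible n T S E"
    by (simp add: lp_feasible_def)
  then show ?thesis
    unfolding lp_value_def by (rule SUP_upper2) (simp add: lp_objective_def)
qed

theorem theorem3p1:
  fixes n T :: nat
    and v :: "nat \<Rightarrow> real"
    and S E :: "nat \<Rightarrow> nat pmf"
    and R :: "'r measure"
  assumes "sse_instance n T v S E"
    and "prob_space R"
  shows "optimal_online_value n v S E R \<le> lp_value n T v S E"
  unfolding optimal_online_value_def
proof (rule SUP_least)
  fix \<pi> :: "'r policy"
  assume \<pi>: "\<pi> \<in> online_policies n R"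
  interpret R: prob_space R by fact
  let ?M = "measure_pmf (realizations n S E)"
  let ?f = "\<lambda>(r, s, e). total_value n v \<pi> r s e"
  let ?L = "lp_value n T v S E"
  interpret RM: pair_sigma_finite R ?M ..
  have seed: "ereal (\<integral>y. ?f (r, y) \<partial>?M) \<le> ?L" if "r \<in> space R" for r
    using total_value_le_lp[of n \<pi> r T v S E] \<pi> that assms(1) by (simp add: online_policies_def)
  show "ereal (policy_value n v S E R \<pi>) \<le> ?L"
  proof (cases "integrable (R \<Otimes>\<^sub>M ?M) ?f")
    case False
    \<comment> \<open>no measurability in the seed needs to be shown: a non-integrable function has integral 0\<close>
    then show ?thesis
      unfolding policy_value_def by (simp add: not_integrable_integral_eq zero_le_lp_value flip: zero_ereal_def)
  next
    case True
    show ?thesis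
    \<comment> \<open>Value plus infinity is trivial, and minus infinity is excluded by the zero
      solution.\<close>
    proof (cases ?L)
      case (real c)
      \<comment> \<open>The bound for each seed survives averaging because \<open>R\<close> has
        total mass 1; Fubini then identifies the iterated integral with the policy value.\<close>
      have "(\<integral>r. (\<integral>y. ?f (r, y) \<partial>?M) \<partial>R) \<le> c"
        using RM.integrable_fst'[OF True] seed real by (intro R.integral_le_const) auto
      then show ?thesis
        using RM.integral_fst'[OF True] real by (simp add: policy_value_def)
    qed (use zero_le_lp_value[of n T v S E] in auto)
  qed
qed

end
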